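(* Suppose $A,B$ are unital C*-algebras and $\theta:U^0(A)\to U^0(B)$ is a continuous group homomorphism such that $\theta(\mathbb{T})=\mathbb{T}$. If $\theta$ is injective, then the following are equivalent: (1) one of $\Lambda_\theta$ or $-\Lambda_\theta$ is positive; (2) $\Lambda_\theta$ is contractive.
   Context: For a unital C*-algebra $A$, $U^0(A)$ is the connected component of $1$ in the unitary group (norm topology); $\mathbb{T}$ is identified with $\mathbb{T}\cdot 1$. $T(A)$ is the set of tracial states, $\operatorname{Aff}T(A)$ the real Banach space (sup norm, pointwise order, order unit the constant $1$) of continuous affine functions $T(A)\to\mathbb{R}$; if $T(A)=\emptyset$ it is the zero space, and any map from or to the zero space is regarded as positive and contractive. For $a\in A_{sa}$ let $\hat a(\tau)=\tau(a)$, and $A_0=\{a\in A_{sa}:\tau(a)=0\ \forall\tau\in T(A)\}$; $[a]\mapsto\hat a$ is an isometric isomorphism $A_{sa}/A_0\cong\operatorname{Aff}T(A)$. A continuous group homomorphism $\theta$ determines a bounded $\mathbb{R}$-linear map $S_\theta:A_{sa}\to B_{sa}$ by $\theta(e^{2\pi i t a})=e^{2\pi i t S_\theta(a)}$ for all $t\in\mathbb{R}$. One has $S_\theta(A_0)\subseteq B_0$, and $\Lambda_\theta:\operatorname{Aff}T(A)\to\operatorname{Aff}T(B)$ is the induced bounded $\mathbb{R}$-linear map $\Lambda_\theta(\hat a)=\widehat{S_\theta(a)}$. *)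

theory Defs
  imports "HOL-Analysis.Analysis"
begin

text \<open>Unital C*-algebras, as complex Banach algebras with an involution satisfying the C*-identity.
  The inherited \<open>norm 1 = 1\<close> excludes only the zero algebra.\<close>

class unital_cstar_algebra = banach + real_normed_algebra_1 +
  fixes scaleC :: "complex \<Rightarrow> 'a \<Rightarrow> 'a" (infixr "*\<^sub>C" 75)
    and star :: "'a \<Rightarrow> 'a"
  assumes scaleC_add_right: "c *\<^sub>C (x + y) = c *\<^sub>C x + c *\<^sub>C y"
    and scaleC_add_left: "(c + d) *\<^sub>C x = c *\<^sub>C x + d *\<^sub>C x"
    and scaleC_scaleC: "c *\<^sub>C d *\<^sub>C x = (c * d) *\<^sub>C x"
    and scaleC_one: "1 *\<^sub>C x = x"
    and scaleR_scaleC: "r *\<^sub>R x = complex_of_real r *\<^sub>C x"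
    and mult_scaleC_left: "(c *\<^sub>C x) * y = c *\<^sub>C (x * y)"
    and mult_scaleC_right: "x * (c *\<^sub>C y) = c *\<^sub>C (x * y)"
    and norm_scaleC: "norm (c *\<^sub>C x) = cmod c * norm x"
    and star_star: "star (star x) = x"
    and star_add: "star (x + y) = star x + star y"
    and star_scaleC: "star (c *\<^sub>C x) = cnj c *\<^sub>C star x"
    and star_mult: "star (x * y) = star y * star x"
    and cstar_identity: "norm (star x * x) = (norm x)\<^sup>2"

instantiation complex :: unital_cstar_algebra
begin

definition scaleC_complex :: "complex \<Rightarrow> complex \<Rightarrow> complex"
  where "scaleC_complex c x = c * x"

definition star_complex :: "complex \<Rightarrow> complex"
  where "star_complex = cnj"

instance
  by standard
    (auto simp: scaleC_complex_def star_complex_def algebra_simps scaleR_conv_of_real norm_mult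
      power2_eq_square)

end

definition unitary_group :: "'a::unital_cstar_algebra set"
  where "unitary_group = {u. star u * u = 1 \<and> u * star u = 1}"

definition U0 :: "'a::unital_cstar_algebra set"
  where "U0 = connected_component_set unitary_group 1"

definition circle :: "'a::unital_cstar_algebra set"
  where "circle = {z *\<^sub>C 1 |z. cmod z = 1}"

definition self_adjoint :: "'a::unital_cstar_algebra set"
  where "self_adjoint = {a. star a = a}"

definition tracial_states :: "('a::unital_cstar_algebra \<Rightarrow> complex) set"
  where "tracial_states =
    {\<tau>. bounded_linear \<tau> \<and> (\<forall>c x. \<tau> (c *\<^sub>C x) = c * \<tau> x) \<and>
       (\<forall>x. \<tau> (star x * x) \<in> \<real>\<^sub>\<ge>\<^sub>0) \<and> onorm \<tau> = 1 \<and>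
       (\<forall>x y. \<tau> (x * y) = \<tau> (y * x))}"

text \<open>Real functions on \<open>T(A)\<close> are encoded as total functions vanishing off \<open>T(A)\<close>, so that equality
  of functions is equality on \<open>T(A)\<close>, and this is the zero space if \<open>T(A)\<close> is empty. The topology on
  the function type is that of pointwise convergence, i.e. the weak* topology on \<open>T(A)\<close>.\<close>

definition AffT :: "(('a::unital_cstar_algebra \<Rightarrow> complex) \<Rightarrow> real) set"
  where "AffT =
    {f. continuous_on tracial_states f \<and>
       (\<forall>\<sigma>\<in>tracial_states. \<forall>\<tau>\<in>tracial_states. \<forall>s\<in>{0..1}.
          f (\<lambda>x. complex_of_real (1 - s) * \<sigma> x + complex_of_real s * \<tau> x) = (1 - s) * f \<sigma> + s * f \<tau>) \<and>
       (\<forall>\<tau>. \<tau> \<notin> tracial_states \<longrightarrow> f \<tau> = 0)}"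

definition sup_norm :: "(('a::unital_cstar_algebra \<Rightarrow> complex) \<Rightarrow> real) \<Rightarrow> real"
  where "sup_norm f =
    (if (tracial_states :: ('a \<Rightarrow> complex) set) = {} then 0 else (SUP \<tau>\<in>tracial_states. \<bar>f \<tau>\<bar>))"

definition hat :: "'a::unital_cstar_algebra \<Rightarrow> ('a \<Rightarrow> complex) \<Rightarrow> real"
  where "hat a = (\<lambda>\<tau>. if \<tau> \<in> tracial_states then Re (\<tau> a) else 0)"

definition S_map ::
  "('a::unital_cstar_algebra \<Rightarrow> 'b::unital_cstar_algebra) \<Rightarrow> 'a \<Rightarrow> 'b"
  where "S_map \<theta> a =
    (THE b. b \<in> self_adjoint \<and>
       (\<forall>t::real. \<theta> (exp ((2 * pi * \<i> * t) *\<^sub>C a)) = exp ((2 * pi * \<i> * t) *\<^sub>C b)))"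

text \<open>\<open>is_Lambda \<theta> \<Lambda>\<close> says that \<open>\<Lambda>\<close> is \<open>\<Lambda>\<^sub>\<theta>\<close>, the bounded linear map induced by \<open>S\<^sub>\<theta>\<close>. Only its
  values on \<open>AffT\<close> matter; there it is unique, since every element of \<open>AffT\<close> is of the form
  \<open>hat a\<close> with \<open>a\<close> self-adjoint.\<close>

definition is_Lambda ::
  "('a::unital_cstar_algebra \<Rightarrow> 'b::unital_cstar_algebra) \<Rightarrow>
   ((('a \<Rightarrow> complex) \<Rightarrow> real) \<Rightarrow> (('b \<Rightarrow> complex) \<Rightarrow> real)) \<Rightarrow> bool"
  where "is_Lambda \<theta> \<Lambda> \<longleftrightarrow>
    \<Lambda> \<in> AffT \<rightarrow> AffT \<and>
    (\<forall>f\<in>AffT. \<forall>g\<in>AffT. \<Lambda> (\<lambda>\<tau>. f \<tau> + g \<tau>) = (\<lambda>\<sigma>. \<Lambda> f \<sigma> + \<Lambda> g \<sigma>)) \<and>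
    (\<forall>r. \<forall>f\<in>AffT. \<Lambda> (\<lambda>\<tau>. r * f \<tau>) = (\<lambda>\<sigma>. r * \<Lambda> f \<sigma>)) \<and>
    (\<exists>K. \<forall>f\<in>AffT. sup_norm (\<Lambda> f) \<le> K * sup_norm f) \<and>
    (\<forall>a\<in>self_adjoint. \<Lambda> (hat a) = hat (S_map \<theta> a))"

definition positive_map ::
  "((('a::unital_cstar_algebra \<Rightarrow> complex) \<Rightarrow> real) \<Rightarrow>
    (('b::unital_cstar_algebra \<Rightarrow> complex) \<Rightarrow> real)) \<Rightarrow> bool"
  where "positive_map \<Lambda> \<longleftrightarrow>
    (\<forall>f\<in>AffT. (\<forall>\<tau>\<in>tracial_states. 0 \<le> f \<tau>) \<longrightarrow> (\<forall>\<sigma>\<in>tracial_states. 0 \<le> \<Lambda> f \<sigma>))"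

definition contractive_map ::
  "((('a::unital_cstar_algebra \<Rightarrow> complex) \<Rightarrow> real) \<Rightarrow>
    (('b::unital_cstar_algebra \<Rightarrow> complex) \<Rightarrow> real)) \<Rightarrow> bool"
  where "contractive_map \<Lambda> \<longleftrightarrow> (\<forall>f\<in>AffT. sup_norm (\<Lambda> f) \<le> sup_norm f)"

end

theory Submission
  imports Defs
begin

text \<open>An injective continuous endomorphism of the circle group is the identity or complex
  conjugation, so \<open>S\<^sub>\<theta> 1 = \<plusminus>1\<close> and one of \<open>\<plusminus>\<Lambda>\<^sub>\<theta>\<close> preserves the order unit. For a linear map
  preserving the order unit, positivity and contractivity are equivalent, because \<open>f\<close> satisfies
  \<open>\<parallel>f\<parallel> \<le> r\<close> exactly when \<open>r \<plusminus> f \<ge> 0\<close>. Weak* compactness of the trace space makes every element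
  of \<open>Aff T(A)\<close> bounded, so that the sup norm is a genuine supremum.\<close>

section \<open>Endomorphisms of the circle group\<close>

text \<open>Subtracting the linear part leaves an additive \<open>k\<close> that vanishes at 1. It
  is therefore 1-periodic, hence bounded by its maximum on \<open>{0..1}\<close>, and a bounded
  additive function is zero because \<open>k (n * t) = n * k t\<close>.\<close>

lemma continuous_additive_real:
  fixes g :: "real \<Rightarrow> real"
  assumes cont: "continuous_on UNIV g" and add: "\<And>s t. g (s + t) = g s + g t"
  shows "g t = g 1 * t"
proof -
  define k where "k t = g t - g 1 * t" for t
  have k_add: "k (s + t) = k s + k t" for s t
    by (simp add: k_def add algebra_simps)
  have k_nat: "k (real n * t) = real n * k t" for n t
  proof (induction n)
    case 0
    show ?case using k_add[of 0 0] by simp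
  next
    case (Suc n)
    then show ?case using k_add[of t "real n * t"] by (simp add: algebra_simps)
  qed
  have k_frac: "k t = k (frac t)" for t
  proof -
    have nat0: "k (real n) = 0" for n
      using k_nat[of n 1] by (simp add: k_def)
    have "k (real_of_int m) = 0" for m
    proof (cases m rule: int_cases2)
      case (nonneg n)
      then show ?thesis using nat0 by simp
    next
      case (nonpos n)
      then show ?thesis using nat0[of n] nat0[of 0] k_add[of "real n" "- real n"] by simp
    qed
    then show ?thesis
      using k_add[of "real_of_int \<lfloor>t\<rfloor>" "frac t"] by (simp add: frac_def)
  qed
  have "continuous_on {0..1} k"
    unfolding k_def by (intro continuous_intros continuous_on_subset[OF cont]) auto
  then have "bounded (k ` {0..1})"
    by (intro compact_imp_bounded compact_continuous_image) auto
  then obtain M where M: "\<And>t. t \<in> {0..1} \<Longrightarrow> \<bar>k t\<bar> \<le> M"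
    by (metis bounded_real imageI)
  have "\<bar>k t\<bar> \<le> M" for t
    using M[of "frac t"] k_frac[of t] frac_ge_0[of t] frac_lt_1[of t] by simp
  then have le: "real n * \<bar>k t\<bar> \<le> M" for n
    using k_nat[of n t] by (metis abs_mult abs_of_nat)
  have "k t = 0"
  proof (rule ccontr)
    assume "k t \<noteq> 0"
    then obtain n where "M < real n * \<bar>k t\<bar>"
      using reals_Archimedean3[of "\<bar>k t\<bar>"] by auto
    then show False using le[of n] by simp
  qed
  then show ?thesis by (simp add: k_def)
qed

text \<open>Contractibility of the line gives a continuous logarithm of \<open>h\<close>. The
  resulting angle is additive up to multiples of \<open>2 * pi\<close>, and continuity removes this
  ambiguity, so the angle is linear.\<close>

lemma continuous_real_character:
  fixes h :: "real \<Rightarrow> complex"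
  assumes cont: "continuous_on UNIV h" and norm_h: "\<And>t. cmod (h t) = 1"
    and hom: "\<And>s t. h (s + t) = h s * h t"
  obtains a where "\<And>t. h t = cis (a * t)"
proof -
  have "\<And>t. h t \<noteq> 0" using norm_h by (metis norm_zero zero_neq_one)
  then obtain l where l: "continuous_on UNIV l" and hl: "\<And>t. h t = exp (l t)"
    using continuous_logarithm_on_contractible[OF cont] by (metis UNIV_I contractible_UNIV)
  \<comment> \<open>Normalising the angle to vanish at 0 does not affect \<open>h\<close>, since
    \<open>h 0 = 1\<close>; it makes the additivity defect \<open>d\<close> below vanish at
    0.\<close>
  define g where "g t = Im (l t) - Im (l 0)" for t
  have h0: "h 0 = 1"
    using hom[of 0 0] \<open>\<And>t. h t \<noteq> 0\<close>[of 0] by simp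
  have Re_l: "Re (l t) = 0" for t
    using norm_h[of t] by (simp add: hl)
  have cis_l: "h t = cis (Im (l t))" for t
    by (simp add: hl exp_eq_polar Re_l)
  have hg: "h t = cis (g t)" for t
    using cis_l[of t] cis_l[of 0] h0 by (simp add: g_def flip: cis_divide)
  have contg: "continuous_on UNIV g"
    unfolding g_def by (intro continuous_intros l)
  have "g (s + t) = g s + g t" for s t
  proof -
    define d where "d x = g (s + x) - g s - g x" for x
    have contd: "continuous_on UNIV d"
      unfolding d_def by (intro continuous_intros continuous_on_compose2[OF contg]) auto
    have dint: "\<exists>n::int. d x = 2 * pi * n" for x
    proof -
      have "cis (d x) = 1"
        using hom[of s x] norm_h by (simp add: d_def hg flip: cis_divide)
      then have "cos (d x) = 1" by (metis cis.sel(1) one_complex.sel(1))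
      then show ?thesis by (auto simp: cos_one_2pi_int mult_ac)
    qed
    \<comment> \<open>Distinct values of \<open>d\<close> are at least \<open>2 * pi\<close> apart,
      so a continuous \<open>d\<close> on the connected line cannot jump.\<close>
    have "d constant_on UNIV"
    proof (rule continuous_discrete_range_constant[OF connected_UNIV contd])
      fix x :: real
      have "2 * pi \<le> norm (d y - d x)" if "d y \<noteq> d x" for y
      proof -
        obtain m n :: int where mn: "d y = 2 * pi * m" "d x = 2 * pi * n" using dint by metis
        then have "1 \<le> \<bar>real_of_int (m - n)\<bar>" using that by (simp flip: of_int_diff of_int_abs)
        then have "2 * pi * 1 \<le> 2 * pi * \<bar>real_of_int (m - n)\<bar>"
          by (intro mult_left_mono) auto
        also have "\<dots> = norm (d y - d x)"
          by (simp add: mn abs_mult flip: right_diff_distrib)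
        finally show ?thesis by simp
      qed
      then show "\<exists>e>0. \<forall>y. y \<in> UNIV \<and> d y \<noteq> d x \<longrightarrow> e \<le> norm (d y - d x)"
        by (intro exI[of _ "2 * pi"]) auto
    qed
    then have "d t = d 0" by (auto simp: constant_on_def)
    then show ?thesis by (simp add: d_def g_def)
  qed
  from continuous_additive_real[OF contg this] have "h t = cis (g 1 * t)" for t
    by (metis hg)
  then show ?thesis by (rule that)
qed

text \<open>Pulled back to the line, the endomorphism becomes multiplication of angles by some
  \<open>a\<close>. Periodicity makes \<open>a\<close> an integer, injectivity makes
  \<open>1 / a\<close> an integer, so \<open>a\<close> is a unit of the integers.\<close>

lemma injective_circle_endomorphism:
  fixes \<phi> :: "complex \<Rightarrow> complex"
  assumes cont: "continuous_on (sphere 0 1) \<phi>" and maps: "\<phi> ` sphere 0 1 \<subseteq> sphere 0 1"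
    and hom: "\<And>z w. cmod z = 1 \<Longrightarrow> cmod w = 1 \<Longrightarrow> \<phi> (z * w) = \<phi> z * \<phi> w"
    and inj: "inj_on \<phi> (sphere 0 1)"
  obtains \<epsilon> :: real where "\<epsilon> = 1 \<or> \<epsilon> = -1" "\<And>t. \<phi> (cis t) = cis (\<epsilon> * t)"
proof -
  have "continuous_on UNIV (\<lambda>t. \<phi> (cis t))"
    by (intro continuous_on_compose2[OF cont] continuous_intros) auto
  moreover have "cmod (\<phi> (cis t)) = 1" for t
    using maps by (force simp: image_subset_iff)
  moreover have "\<phi> (cis (s + t)) = \<phi> (cis s) * \<phi> (cis t)" for s t
    by (simp add: hom flip: cis_mult)
  ultimately obtain a where a: "\<And>t. \<phi> (cis t) = cis (a * t)"
    using continuous_real_character[of "\<lambda>t. \<phi> (cis t)"] by metis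
  have \<phi>1: "\<phi> 1 = 1" using a[of 0] by simp
  have ker: "cis t = 1" if "cis (a * t) = 1" for t
    using inj_onD[OF inj, of "cis t" 1] that a[of t] \<phi>1 by simp
  have "cis (a * (2 * pi)) = 1" using a[of "2 * pi"] \<phi>1 by simp
  then have "cos (a * (2 * pi)) = 1" by (metis cis.sel(1) one_complex.sel(1))
  then obtain n :: int where "a * (2 * pi) = real_of_int n * 2 * pi"
    by (auto simp: cos_one_2pi_int)
  then have n: "a = real_of_int n" by simp
  \<comment> \<open>For \<open>a = 0\<close> the kernel would contain
    \<open>cis pi = -1\<close>.\<close>
  have a0: "a \<noteq> 0"
    using ker[of pi] by (auto simp: cis_pi)
  \<comment> \<open>The angle \<open>2 * pi / a\<close> is sent to a full turn, so it lies in the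
    trivial kernel.\<close>
  have "cis (2 * pi / a) = 1"
    by (rule ker) (simp add: a0)
  then have "cos (2 * pi / a) = 1" by (metis cis.sel(1) one_complex.sel(1))
  then obtain m :: int where "2 * pi / a = real_of_int m * 2 * pi"
    by (auto simp: cos_one_2pi_int)
  then have "1 = real_of_int m * a" using a0 by (simp add: field_simps)
  then have "1 = m * n" unfolding n by (metis of_int_1 of_int_eq_iff of_int_mult)
  then have "n = 1 \<or> n = -1" by (metis mult.commute zmult_eq_1_iff)
  then show ?thesis using that[of a] a n by auto
qed

section \<open>Unitaries and the value of \<open>S\<^sub>\<theta>\<close> at the unit\<close>

lemma star_one [simp]: "star (1 :: 'a::unital_cstar_algebra) = 1"
  by (metis mult_1 mult_1_right star_mult star_star)

lemma bounded_linear_scaleC_one: "bounded_linear (\<lambda>z. z *\<^sub>C (1 :: 'a::unital_cstar_algebra))"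
  by (rule bounded_linear_intro[where K = 1])
    (auto simp: scaleC_add_left norm_scaleC scaleR_scaleC[where 'a = 'a] scaleC_scaleC
      scaleR_conv_of_real[where 'a = complex])

lemma scaleC_one_eq_iff:
  "z *\<^sub>C (1 :: 'a::unital_cstar_algebra) = w *\<^sub>C 1 \<longleftrightarrow> z = w"
proof
  interpret bounded_linear "\<lambda>z. z *\<^sub>C (1 :: 'a)" by (rule bounded_linear_scaleC_one)
  assume "z *\<^sub>C (1 :: 'a) = w *\<^sub>C 1"
  then have "norm ((z - w) *\<^sub>C (1 :: 'a)) = 0" by (simp add: diff)
  then show "z = w" by (simp add: norm_scaleC)
qed auto

lemma scaleC_one_mult:
  "z *\<^sub>C (1 :: 'a::unital_cstar_algebra) * w *\<^sub>C 1 = (z * w) *\<^sub>C 1"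
  by (simp add: mult_scaleC_left mult_scaleC_right scaleC_scaleC mult.commute)

text \<open>The embedding of the scalars is multiplicative and bounded linear, so it commutes with
  the exponential series term by term.\<close>

lemma exp_scaleC_one: "exp (z *\<^sub>C (1 :: 'a::unital_cstar_algebra)) = exp z *\<^sub>C 1"
proof -
  interpret bounded_linear "\<lambda>z. z *\<^sub>C (1 :: 'a)" by (rule bounded_linear_scaleC_one)
  have "(z *\<^sub>C (1 :: 'a)) ^ n = (z ^ n) *\<^sub>C 1" for n
    by (induction n) (simp_all add: scaleC_one scaleC_one_mult)
  then have "exp (z *\<^sub>C (1 :: 'a)) = (\<Sum>n. (z ^ n /\<^sub>R fact n) *\<^sub>C 1)"
    by (simp add: exp_def scaleR)
  also have "\<dots> = exp z *\<^sub>C 1"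
    unfolding exp_def by (rule suminf[symmetric, OF summable_exp_generic])
  finally show ?thesis .
qed

lemma circle_eq_image: "circle = (\<lambda>z. z *\<^sub>C (1 :: 'a::unital_cstar_algebra)) ` sphere 0 1"
  by (auto simp: circle_def)

text \<open>The scalar circle is a connected set of unitaries through 1. This places it where
  \<open>\<theta>\<close> is known to be continuous, multiplicative and injective.\<close>

lemma circle_subset_U0: "circle \<subseteq> (U0 :: 'a::unital_cstar_algebra set)"
  unfolding U0_def
proof (rule connected_component_maximal)
  show "(1 :: 'a) \<in> circle"
    by (auto simp: circle_def scaleC_one intro!: exI[of _ 1])
  show "connected (circle :: 'a set)"
    unfolding circle_eq_image
    by (intro connected_continuous_image linear_continuous_on bounded_linear_scaleC_one
        connected_sphere) simp
  show "circle \<subseteq> (unitary_group :: 'a set)"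
    by (auto simp: circle_def unitary_group_def star_scaleC scaleC_one_mult scaleC_one
        complex_norm_square[symmetric] mult.commute[of "cnj _"])
qed

text \<open>The generator is recovered by differentiating at \<open>t = 0\<close>. This supplies the
  uniqueness needed for the definite description in \<open>S_map\<close>.\<close>

lemma exp_one_parameter_group_unique:
  fixes b c :: "'a::unital_cstar_algebra"
  assumes "\<And>t::real. exp ((2 * pi * \<i> * t) *\<^sub>C b) = exp ((2 * pi * \<i> * t) *\<^sub>C c)"
  shows "b = c"
proof -
  have "(2 * pi * \<i> * complex_of_real t) *\<^sub>C x = t *\<^sub>R ((2 * pi * \<i>) *\<^sub>C x)" for t and x :: 'a
    by (simp add: scaleR_scaleC scaleC_scaleC mult_ac)
  then have eq: "(\<lambda>t. exp (t *\<^sub>R ((2 * pi * \<i>) *\<^sub>C b))) = (\<lambda>t. exp (t *\<^sub>R ((2 * pi * \<i>) *\<^sub>C c)))"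
    using assms by simp
  have deriv: "((\<lambda>t. exp (t *\<^sub>R x)) has_vector_derivative x) (at 0)" for x :: 'a
    using exp_scaleR_has_vector_derivative_right[of x 0 UNIV] by simp
  have "(2 * pi * \<i>) *\<^sub>C b = (2 * pi * \<i>) *\<^sub>C c"
    using deriv[of "(2 * pi * \<i>) *\<^sub>C b", unfolded eq] deriv by (rule vector_derivative_unique_at)
  moreover have "inverse (2 * pi * \<i>) *\<^sub>C (2 * pi * \<i>) *\<^sub>C x = x" for x :: 'a
    unfolding scaleC_scaleC by (subst left_inverse) (simp_all add: scaleC_one)
  ultimately show ?thesis by metis
qed

text \<open>On the circle, \<open>\<theta>\<close> acts as an injective continuous endomorphism
  \<open>\<phi>\<close> of the scalars of modulus one. The one-parameter group generated by 1 stays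
  in the circle, so the sign classifying \<open>\<phi>\<close> determines its image
  generator.\<close>

lemma S_map_one:
  fixes \<theta> :: "'a::unital_cstar_algebra \<Rightarrow> 'b::unital_cstar_algebra"
  assumes cont: "continuous_on U0 \<theta>"
    and hom: "\<forall>u\<in>U0. \<forall>v\<in>U0. \<theta> (u * v) = \<theta> u * \<theta> v"
    and circ: "\<theta> ` circle = circle"
    and inj: "inj_on \<theta> U0"
  obtains \<epsilon> :: real where "\<epsilon> = 1 \<or> \<epsilon> = -1" "S_map \<theta> 1 = \<epsilon> *\<^sub>R 1"
proof -
  have mem: "z *\<^sub>C 1 \<in> (circle :: 'a set)" if "cmod z = 1" for z
    using that by (auto simp: circle_def)
  have "\<exists>w. cmod w = 1 \<and> \<theta> (z *\<^sub>C 1) = w *\<^sub>C 1" if "cmod z = 1" for z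
  proof -
    have "\<theta> (z *\<^sub>C 1) \<in> circle" using circ mem[OF that] by blast
    then show ?thesis by (auto simp: circle_def)
  qed
  then obtain \<phi> where norm_\<phi>: "\<And>z. cmod z = 1 \<Longrightarrow> cmod (\<phi> z) = 1"
    and \<phi>: "\<And>z. cmod z = 1 \<Longrightarrow> \<theta> (z *\<^sub>C 1) = \<phi> z *\<^sub>C 1"
    by metis
  have U: "z *\<^sub>C 1 \<in> (U0 :: 'a set)" if "cmod z = 1" for z
    using mem[OF that] circle_subset_U0 by auto
  interpret B: bounded_linear "\<lambda>z. z *\<^sub>C (1 :: 'b)" by (rule bounded_linear_scaleC_one)
  have "continuous_on (sphere 0 1) (\<lambda>z. \<theta> (z *\<^sub>C 1))"
    by (intro continuous_on_compose2[OF cont] linear_continuous_on bounded_linear_scaleC_one)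
      (auto simp: U)
  then have cont': "continuous_on (sphere 0 1) (\<lambda>z. \<phi> z *\<^sub>C (1 :: 'b))"
    by (rule continuous_on_eq) (simp add: \<phi>)
  have "continuous_on (sphere 0 1) \<phi>"
  proof -
    \<comment> \<open>The scalar embedding is isometric because \<open>norm 1 = 1\<close>, so
      continuity can be read off after embedding.\<close>
    have "dist (\<phi> z) (\<phi> w) = dist (\<phi> z *\<^sub>C (1 :: 'b)) (\<phi> w *\<^sub>C 1)" for z w
      by (simp add: dist_norm norm_scaleC flip: B.diff)
    then show ?thesis using cont' by (simp add: continuous_on_iff)
  qed
  moreover have "\<phi> ` sphere 0 1 \<subseteq> sphere 0 1" using norm_\<phi> by auto
  moreover have "\<phi> (z * w) = \<phi> z * \<phi> w" if "cmod z = 1" "cmod w = 1" for z w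
  proof -
    have "\<phi> (z * w) *\<^sub>C (1 :: 'b) = \<theta> (z *\<^sub>C 1 * w *\<^sub>C 1)"
      using that by (simp add: \<phi> norm_mult scaleC_one_mult)
    also have "\<dots> = (\<phi> z * \<phi> w) *\<^sub>C 1"
      using hom U[OF that(1)] U[OF that(2)] \<phi>[OF that(1)] \<phi>[OF that(2)]
      by (metis scaleC_one_mult)
    finally show ?thesis by (simp add: scaleC_one_eq_iff)
  qed
  moreover have "inj_on \<phi> (sphere 0 1)"
  proof (rule inj_onI)
    fix z w assume zw: "z \<in> sphere 0 1" "w \<in> sphere 0 1" "\<phi> z = \<phi> w"
    then have "\<theta> (z *\<^sub>C 1) = \<theta> (w *\<^sub>C 1)" by (simp add: \<phi>)
    then have "z *\<^sub>C (1 :: 'a) = w *\<^sub>C 1" using inj_onD[OF inj] U zw by simp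
    then show "z = w" by (simp add: scaleC_one_eq_iff)
  qed
  ultimately obtain \<epsilon> :: real where \<epsilon>: "\<epsilon> = 1 \<or> \<epsilon> = -1"
    and \<phi>cis: "\<And>t. \<phi> (cis t) = cis (\<epsilon> * t)"
    using injective_circle_endomorphism[of \<phi>] by metis
  have exp_cis: "exp (2 * pi * \<i> * complex_of_real t) = cis (2 * pi * t)" for t
    by (simp add: cis_conv_exp mult_ac)
  have "S_map \<theta> 1 = \<epsilon> *\<^sub>R 1"
    unfolding S_map_def
  proof (rule the_equality)
    have "\<theta> (exp ((2 * pi * \<i> * t) *\<^sub>C 1)) = exp ((2 * pi * \<i> * t) *\<^sub>C (\<epsilon> *\<^sub>R 1))" for t :: real
    proof -
      have "\<theta> (exp ((2 * pi * \<i> * t) *\<^sub>C 1)) = cis (2 * pi * (t * \<epsilon>)) *\<^sub>C 1"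
        unfolding exp_scaleC_one exp_cis \<phi>[OF norm_cis] \<phi>cis by (simp add: mult_ac)
      also have "\<dots> = exp ((2 * pi * \<i> * t) *\<^sub>C (\<epsilon> *\<^sub>R 1))"
        unfolding exp_cis[symmetric] exp_scaleC_one[symmetric]
        by (simp add: scaleR_scaleC scaleC_scaleC mult_ac)
      finally show ?thesis .
    qed
    moreover have "\<epsilon> *\<^sub>R 1 \<in> (self_adjoint :: 'b set)"
      by (simp add: self_adjoint_def scaleR_scaleC star_scaleC)
    ultimately show *: "\<epsilon> *\<^sub>R (1 :: 'b) \<in> self_adjoint \<and>
        (\<forall>t::real. \<theta> (exp ((2 * pi * \<i> * t) *\<^sub>C 1)) = exp ((2 * pi * \<i> * t) *\<^sub>C (\<epsilon> *\<^sub>R 1)))"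
      by blast
    show "b = \<epsilon> *\<^sub>R 1" if "b \<in> self_adjoint \<and>
        (\<forall>t::real. \<theta> (exp ((2 * pi * \<i> * t) *\<^sub>C 1)) = exp ((2 * pi * \<i> * t) *\<^sub>C b))" for b
    proof (rule exp_one_parameter_group_unique)
      fix t :: real
      show "exp ((2 * pi * \<i> * t) *\<^sub>C b) = exp ((2 * pi * \<i> * t) *\<^sub>C (\<epsilon> *\<^sub>R 1))"
        using conjunct2[OF that, rule_format, of t] conjunct2[OF *, rule_format, of t]
        by (rule trans[OF sym])
    qed
  qed
  with \<epsilon> show ?thesis by (rule that)
qed

section \<open>Compactness of the trace space\<close>

text \<open>Positivity on \<open>x + c 1\<close> gives a quadratic inequality in the scalar
  \<open>c\<close>; a suitable choice of \<open>c\<close> along the direction of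
  \<open>\<tau> x\<close> yields the bound.\<close>

lemma positive_functional_Cauchy_Schwarz:
  fixes \<tau> :: "'a::unital_cstar_algebra \<Rightarrow> complex"
  assumes add: "\<And>x y. \<tau> (x + y) = \<tau> x + \<tau> y"
    and scale: "\<And>c x. \<tau> (c *\<^sub>C x) = c * \<tau> x"
    and pos: "\<And>x. \<tau> (star x * x) \<in> \<real>\<^sub>\<ge>\<^sub>0"
  shows "(cmod (\<tau> x))\<^sup>2 \<le> Re (\<tau> 1) * Re (\<tau> (star x * x))"
proof -
  define p q e where "p = \<tau> (star x * x)" and "q = \<tau> x" and "e = \<tau> 1"
  have e: "Re e \<ge> 0" "Im e = 0" and p: "Re p \<ge> 0" "Im p = 0"
    using pos[of 1] pos[of x] by (auto simp: e_def p_def complex_nonneg_Reals_iff)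
  have "star (x + c *\<^sub>C 1) * (x + c *\<^sub>C 1) =
      star x * x + c *\<^sub>C star x + cnj c *\<^sub>C x + (cnj c * c) *\<^sub>C 1" for c
    by (simp add: star_add star_scaleC algebra_simps mult_scaleC_left mult_scaleC_right
        scaleC_scaleC scaleC_add_right)
  then have "\<tau> (star (x + c *\<^sub>C 1) * (x + c *\<^sub>C 1)) = p + c * \<tau> (star x) + cnj c * q + (cnj c * c) * e"
    for c
    by (simp add: add scale p_def q_def e_def)
  with pos have quad: "p + c * \<tau> (star x) + cnj c * q + (cnj c * c) * e \<in> \<real>\<^sub>\<ge>\<^sub>0" for c
    by metis
  \<comment> \<open>The expression must be real: \<open>c = 1\<close> compares the imaginary parts
    of \<open>\<tau> (star x)\<close> and \<open>q\<close>, and \<open>c = \<i>\<close> compares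
    their real parts.\<close>
  have "\<tau> (star x) = cnj q"
    using quad[of 1] quad[of \<i>] e p by (auto simp: complex_nonneg_Reals_iff complex_eq_iff)
  then have quad': "0 \<le> Re p + 2 * Re (cnj c * q) + (cmod c)\<^sup>2 * Re e" for c
    using quad[of c] e unfolding cmod_power2
    by (simp add: complex_nonneg_Reals_iff power2_eq_square algebra_simps)
  have ineq: "0 \<le> Re p - 2 * t * (cmod q)\<^sup>2 + t\<^sup>2 * (cmod q)\<^sup>2 * Re e" for t
    using quad'[of "- (of_real t * q)"]
    unfolding cmod_power2 by (simp add: power2_eq_square algebra_simps)
  have "(cmod q)\<^sup>2 \<le> Re e * Re p"
  proof (cases "Re e = 0")
    case True
    have "(cmod q)\<^sup>2 = 0"
    proof (rule ccontr)
      assume "(cmod q)\<^sup>2 \<noteq> 0"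
      \<comment> \<open>With no quadratic term the bound is linear in \<open>t\<close>, and this
        \<open>t\<close> brings it down to \<open>- Re p - 2\<close>.\<close>
      then show False using ineq[of "(Re p + 1) / (cmod q)\<^sup>2"] True p by simp
    qed
    then show ?thesis using True by simp
  next
    case False
    \<comment> \<open>This \<open>t\<close> minimises the quadratic.\<close>
    then show ?thesis using ineq[of "1 / Re e"] e
      by (simp add: field_simps power2_eq_square)
  qed
  then show ?thesis by (simp add: p_def q_def e_def)
qed

text \<open>Trades the operator norm condition for conditions on individual values of
  \<open>\<tau>\<close>, each closed under pointwise limits, as the compactness argument requires.
  The essential point is that norm one forces \<open>\<tau> 1 = 1\<close>: by Cauchy-Schwarz and the
  C*-identity, the norm of \<open>\<tau>\<close> is at most the square root of
  \<open>\<tau> 1\<close>.\<close>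

lemma tracial_states_alt:
  "(tracial_states :: ('a::unital_cstar_algebra \<Rightarrow> complex) set) =
    {\<tau>. (\<forall>x y. \<tau> (x + y) = \<tau> x + \<tau> y) \<and> (\<forall>c x. \<tau> (c *\<^sub>C x) = c * \<tau> x) \<and>
       (\<forall>x. \<tau> (star x * x) \<in> \<real>\<^sub>\<ge>\<^sub>0) \<and> (\<forall>x. \<tau> x \<in> cball 0 (norm x)) \<and> \<tau> 1 = 1 \<and>
       (\<forall>x y. \<tau> (x * y) = \<tau> (y * x))}" (is "_ = ?R")
proof (intro equalityI subsetI)
  fix \<tau> :: "'a \<Rightarrow> complex" assume "\<tau> \<in> tracial_states"
  then have bl: "bounded_linear \<tau>" and scale: "\<And>c x. \<tau> (c *\<^sub>C x) = c * \<tau> x"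
    and pos: "\<And>x. \<tau> (star x * x) \<in> \<real>\<^sub>\<ge>\<^sub>0" and on: "onorm \<tau> = 1"
    and tr: "\<And>x y. \<tau> (x * y) = \<tau> (y * x)"
    by (auto simp: tracial_states_def)
  have add: "\<And>x y. \<tau> (x + y) = \<tau> x + \<tau> y"
    by (rule linear_add[OF bounded_linear.linear[OF bl]])
  have le: "cmod (\<tau> x) \<le> norm x" for x
    using onorm[OF bl, of x] on by simp
  have e: "Re (\<tau> 1) \<ge> 0" "Im (\<tau> 1) = 0"
    using pos[of 1] by (auto simp: complex_nonneg_Reals_iff)
  have "cmod (\<tau> x) \<le> sqrt (Re (\<tau> 1)) * norm x" for x
  proof -
    have "Re (\<tau> (star x * x)) \<le> (norm x)\<^sup>2"
      using le[of "star x * x"] complex_Re_le_cmod[of "\<tau> (star x * x)"]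
      by (simp add: cstar_identity)
    then have "(cmod (\<tau> x))\<^sup>2 \<le> Re (\<tau> 1) * (norm x)\<^sup>2"
      using positive_functional_Cauchy_Schwarz[OF add scale pos, of x] e
      by (meson mult_left_mono order_trans)
    then show ?thesis
      by (metis real_sqrt_le_mono real_sqrt_mult real_sqrt_abs abs_norm_cancel)
  qed
  then have "onorm \<tau> \<le> sqrt (Re (\<tau> 1))"
    by (intro onorm_bound) (use e in auto)
  then have "1 \<le> Re (\<tau> 1)" using on by simp
  moreover have "Re (\<tau> 1) \<le> 1"
    using le[of 1] complex_Re_le_cmod[of "\<tau> 1"] by simp
  ultimately have "\<tau> 1 = 1" using e by (simp add: complex_eq_iff)
  then show "\<tau> \<in> ?R" using scale pos tr le by (auto simp: add)
next
  fix \<tau> :: "'a \<Rightarrow> complex" assume "\<tau> \<in> ?R"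
  then have add: "\<And>x y. \<tau> (x + y) = \<tau> x + \<tau> y" and scale: "\<And>c x. \<tau> (c *\<^sub>C x) = c * \<tau> x"
    and pos: "\<And>x. \<tau> (star x * x) \<in> \<real>\<^sub>\<ge>\<^sub>0" and le: "\<And>x. cmod (\<tau> x) \<le> norm x" and one: "\<tau> 1 = 1"
    and tr: "\<And>x y. \<tau> (x * y) = \<tau> (y * x)"
    by auto
  have bl: "bounded_linear \<tau>"
    by (rule bounded_linear_intro[where K = 1])
      (auto simp: add le scale scaleR_scaleC[where 'a = 'a] scaleR_conv_of_real)
  have "onorm \<tau> \<le> 1" by (rule onorm_bound) (auto simp: le)
  moreover have "1 \<le> onorm \<tau>" using onorm[OF bl, of 1] one by simp
  ultimately show "\<tau> \<in> tracial_states"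
    using bl scale pos tr by (auto simp: tracial_states_def)
qed

text \<open>This is the Banach-Alaoglu argument: by Tychonoff the product of the discs of radius
  \<open>norm x\<close> is compact, and the remaining conditions cut out a pointwise closed
  subset.\<close>

lemma compact_tracial_states:
  "compact (tracial_states :: ('a::unital_cstar_algebra \<Rightarrow> complex) set)"
proof -
  let ?P = "PiE UNIV (\<lambda>x::'a. cball (0::complex) (norm x))"
  let ?C = "{\<tau>::'a \<Rightarrow> complex. (\<forall>x y. \<tau> (x + y) = \<tau> x + \<tau> y) \<and> (\<forall>c x. \<tau> (c *\<^sub>C x) = c * \<tau> x) \<and>
       (\<forall>x. \<tau> (star x * x) \<in> \<real>\<^sub>\<ge>\<^sub>0) \<and> \<tau> 1 = 1 \<and> (\<forall>x y. \<tau> (x * y) = \<tau> (y * x))}"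
  have "compactin (product_topology (\<lambda>i. euclidean) UNIV) ?P"
    by (subst compactin_PiE) auto
  then have "compact ?P"
    by (simp add: euclidean_product_topology)
  moreover have "closed ?C"
  proof -
    have *: "closed {\<tau>::'a \<Rightarrow> complex. \<tau> x \<in> \<real>\<^sub>\<ge>\<^sub>0}" for x
      using closed_vimage[OF closed_nonneg_Reals_complex, of "\<lambda>\<tau>::'a \<Rightarrow> complex. \<tau> x"]
      by (simp add: vimage_def)
    show ?thesis
      by (intro closed_Collect_conj closed_Collect_all closed_Collect_eq * continuous_intros
          continuous_on_product_coordinates)
  qed
  ultimately have "compact (?P \<inter> ?C)" by (rule compact_Int_closed)
  also have "?P \<inter> ?C = tracial_states"
    unfolding tracial_states_alt PiE_UNIV_domain Pi_def by blast
  finally show ?thesis .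
qed

section \<open>The order unit space of affine functions\<close>

lemma AffT_bdd_above: "f \<in> AffT \<Longrightarrow> bdd_above ((\<lambda>\<tau>. \<bar>f \<tau>\<bar>) ` tracial_states)"
proof -
  assume "f \<in> AffT"
  then have "continuous_on tracial_states (\<lambda>\<tau>. \<bar>f \<tau>\<bar>)"
    by (auto simp: AffT_def intro!: continuous_intros)
  then show ?thesis
    by (intro bounded_imp_bdd_above compact_imp_bounded compact_continuous_image
        compact_tracial_states)
qed

lemma abs_le_sup_norm: "f \<in> AffT \<Longrightarrow> \<tau> \<in> tracial_states \<Longrightarrow> \<bar>f \<tau>\<bar> \<le> sup_norm f"
  using cSUP_upper[OF _ AffT_bdd_above] by (auto simp: sup_norm_def)

lemma sup_norm_nonneg: "f \<in> AffT \<Longrightarrow> 0 \<le> sup_norm (f :: ('a::unital_cstar_algebra \<Rightarrow> complex) \<Rightarrow> real)"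
proof (cases "(tracial_states :: ('a \<Rightarrow> complex) set) = {}")
  case False
  assume "f \<in> AffT"
  with False show ?thesis by (meson abs_ge_zero abs_le_sup_norm ex_in_conv order_trans)
qed (simp add: sup_norm_def)

text \<open>The bound \<open>0 \<le> r\<close> covers an empty trace space, where
  \<open>sup_norm\<close> takes the value 0.\<close>

lemma sup_norm_le:
  assumes "0 \<le> r" "\<And>\<tau>. \<tau> \<in> tracial_states \<Longrightarrow> \<bar>f \<tau>\<bar> \<le> r"
  shows "sup_norm f \<le> r"
  using assms by (auto simp: sup_norm_def intro!: cSUP_least)

text \<open>Since \<open>hat 1\<close> is 1 on traces and 0 elsewhere, it is affine only because
  mixtures of traces are again traces.\<close>

lemma tracial_states_convex:
  assumes "\<sigma> \<in> tracial_states" "\<tau> \<in> tracial_states" "s \<in> {0..1::real}"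
  shows "(\<lambda>x. complex_of_real (1 - s) * \<sigma> x + complex_of_real s * \<tau> x) \<in> tracial_states"
proof -
  have "cmod (complex_of_real (1 - s) * \<sigma> x + complex_of_real s * \<tau> x) \<le> norm x" for x
  proof -
    have "cmod (complex_of_real (1 - s) * \<sigma> x + complex_of_real s * \<tau> x)
        \<le> (1 - s) * cmod (\<sigma> x) + s * cmod (\<tau> x)"
      using assms(3) norm_triangle_ineq[of "complex_of_real (1 - s) * \<sigma> x" "complex_of_real s * \<tau> x"]
      by (simp add: norm_mult del: of_real_diff)
    also have "\<dots> \<le> (1 - s) * norm x + s * norm x"
      using assms by (intro add_mono mult_left_mono) (auto simp: tracial_states_alt)
    finally show ?thesis by (simp add: algebra_simps)
  qed
  moreover have "complex_of_real (1 - s) * \<sigma> (star x * x) + complex_of_real s * \<tau> (star x * x) \<in> \<real>\<^sub>\<ge>\<^sub>0"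
    for x
  proof (intro nonneg_Reals_add_I nonneg_Reals_mult_I)
    show "\<sigma> (star x * x) \<in> \<real>\<^sub>\<ge>\<^sub>0" "\<tau> (star x * x) \<in> \<real>\<^sub>\<ge>\<^sub>0"
      using assms(1,2) unfolding tracial_states_def by blast+
  qed (use assms(3) in \<open>auto simp: complex_nonneg_Reals_iff\<close>)
  moreover have "\<sigma> (x * y) = \<sigma> (y * x)" "\<tau> (x * y) = \<tau> (y * x)" for x y
    using assms(1,2) unfolding tracial_states_def by blast+
  ultimately show ?thesis
    using assms(1,2) unfolding tracial_states_alt by (simp add: algebra_simps)
qed

lemma hat_one: "\<tau> \<in> tracial_states \<Longrightarrow> hat 1 \<tau> = 1"
  by (auto simp: hat_def tracial_states_alt)

lemma hat_one_AffT: "hat (1 :: 'a::unital_cstar_algebra) \<in> AffT"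
proof -
  have "continuous_on tracial_states (hat (1 :: 'a))"
    by (rule continuous_on_eq[OF continuous_on_const[of _ 1]]) (simp add: hat_one)
  then show ?thesis
    by (auto simp: AffT_def hat_one tracial_states_convex simp del: of_real_diff) (simp add: hat_def)
qed

lemma AffT_add: "f \<in> AffT \<Longrightarrow> g \<in> AffT \<Longrightarrow> (\<lambda>\<tau>. f \<tau> + g \<tau>) \<in> AffT"
  unfolding AffT_def
  by (auto intro!: continuous_intros simp: distrib_left simp del: of_real_diff)

lemma AffT_scale: "f \<in> AffT \<Longrightarrow> (\<lambda>\<tau>. r * f \<tau>) \<in> AffT"
  unfolding AffT_def
  by (auto intro!: continuous_intros simp: distrib_left mult.left_commute simp del: of_real_diff)

text \<open>A positive map is applied to the nonnegative functions \<open>sup_norm f\<close> plus or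
  minus \<open>f\<close>. Conversely, for \<open>f\<close> nonnegative,
  \<open>sup_norm f - f\<close> lies between 0 and \<open>sup_norm f\<close>; contractivity then
  bounds \<open>sup_norm f - M f\<close> by \<open>sup_norm f\<close>.\<close>

lemma unital_positive_iff_contractive:
  fixes M :: "(('a::unital_cstar_algebra \<Rightarrow> complex) \<Rightarrow> real) \<Rightarrow>
    (('b::unital_cstar_algebra \<Rightarrow> complex) \<Rightarrow> real)"
  assumes maps: "\<And>f. f \<in> AffT \<Longrightarrow> M f \<in> AffT"
    and add: "\<And>f g. f \<in> AffT \<Longrightarrow> g \<in> AffT \<Longrightarrow> M (\<lambda>\<tau>. f \<tau> + g \<tau>) = (\<lambda>\<sigma>. M f \<sigma> + M g \<sigma>)"
    and scale: "\<And>r f. f \<in> AffT \<Longrightarrow> M (\<lambda>\<tau>. r * f \<tau>) = (\<lambda>\<sigma>. r * M f \<sigma>)"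
    and unital: "M (hat 1) = hat 1"
  shows "positive_map M \<longleftrightarrow> contractive_map M"
proof -
  have comb: "(\<lambda>\<tau>. r * hat 1 \<tau> + s * f \<tau>) \<in> AffT"
    "\<sigma> \<in> tracial_states \<Longrightarrow> M (\<lambda>\<tau>. r * hat 1 \<tau> + s * f \<tau>) \<sigma> = r + s * M f \<sigma>"
    if "f \<in> AffT" for r s f \<sigma>
    using that
    by (auto intro!: AffT_add AffT_scale hat_one_AffT simp: add scale AffT_scale hat_one_AffT
        unital hat_one)
  show ?thesis
  proof
    assume pos: "positive_map M"
    show "contractive_map M"
      unfolding contractive_map_def
    proof (intro ballI sup_norm_le)
      fix f :: "('a \<Rightarrow> complex) \<Rightarrow> real" assume f: "f \<in> AffT"
      then show "0 \<le> sup_norm f" by (rule sup_norm_nonneg)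
      fix \<sigma> :: "'b \<Rightarrow> complex" assume \<sigma>: "\<sigma> \<in> tracial_states"
      have "0 \<le> sup_norm f + s * M f \<sigma>" if "s = 1 \<or> s = -1" for s
      proof -
        have "0 \<le> sup_norm f * hat 1 \<tau> + s * f \<tau>" if "\<tau> \<in> tracial_states" for \<tau>
          using abs_le_sup_norm[OF f that] \<open>s = 1 \<or> s = -1\<close> that by (auto simp: hat_one)
        then have "0 \<le> M (\<lambda>\<tau>. sup_norm f * hat 1 \<tau> + s * f \<tau>) \<sigma>"
          using pos comb(1)[OF f] \<sigma> by (auto simp: positive_map_def)
        then show ?thesis by (simp add: comb(2)[OF f \<sigma>])
      qed
      from this[of 1] this[of "-1"] show "\<bar>M f \<sigma>\<bar> \<le> sup_norm f" by auto
    qed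
  next
    assume contr: "contractive_map M"
    show "positive_map M"
      unfolding positive_map_def
    proof (intro ballI impI)
      fix f :: "('a \<Rightarrow> complex) \<Rightarrow> real" and \<sigma> :: "'b \<Rightarrow> complex"
      assume f: "f \<in> AffT" and nonneg: "\<forall>\<tau>\<in>tracial_states. 0 \<le> f \<tau>"
        and \<sigma>: "\<sigma> \<in> tracial_states"
      let ?g = "\<lambda>\<tau>. sup_norm f * hat 1 \<tau> + (-1) * f \<tau>"
      have g: "?g \<in> AffT" by (rule comb(1)[OF f])
      have "sup_norm f + (-1) * M f \<sigma> = M ?g \<sigma>" by (rule comb(2)[OF f \<sigma>, symmetric])
      also have "\<dots> \<le> sup_norm (M ?g)"
        using abs_le_sup_norm[OF maps[OF g] \<sigma>] by linarith
      also have "\<dots> \<le> sup_norm ?g" using contr g by (auto simp: contractive_map_def)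
      also have "\<dots> \<le> sup_norm f"
      proof (rule sup_norm_le[OF sup_norm_nonneg[OF f]])
        fix \<tau> :: "'a \<Rightarrow> complex" assume "\<tau> \<in> tracial_states"
        then show "\<bar>?g \<tau>\<bar> \<le> sup_norm f"
          using nonneg abs_le_sup_norm[OF f] by (fastforce simp: hat_one)
      qed
      finally show "0 \<le> M f \<sigma>" by simp
    qed
  qed
qed

section \<open>Reduction of the equivalence to the unital case\<close>

lemma contractive_map_uminus: "contractive_map (\<lambda>f \<sigma>. - M f \<sigma>) \<longleftrightarrow> contractive_map M"
  by (simp add: contractive_map_def sup_norm_def)

theorem lemma4p3:
  fixes \<theta> :: "'a::unital_cstar_algebra \<Rightarrow> 'b::unital_cstar_algebra"
    and \<Lambda> :: "(('a \<Rightarrow> complex) \<Rightarrow> real) \<Rightarrow> (('b \<Rightarrow> complex) \<Rightarrow> real)"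
  assumes "\<theta> \<in> U0 \<rightarrow> U0"
    and "continuous_on U0 \<theta>"
    and "\<forall>u\<in>U0. \<forall>v\<in>U0. \<theta> (u * v) = \<theta> u * \<theta> v"
    and "\<theta> ` circle = circle"
    and "inj_on \<theta> U0"
    and "is_Lambda \<theta> \<Lambda>"
  shows "(positive_map \<Lambda> \<or> positive_map (\<lambda>f \<sigma>. - \<Lambda> f \<sigma>)) \<longleftrightarrow> contractive_map \<Lambda>"
proof -
  have maps: "\<And>f. f \<in> AffT \<Longrightarrow> \<Lambda> f \<in> AffT"
    and add: "\<And>f g. f \<in> AffT \<Longrightarrow> g \<in> AffT \<Longrightarrow> \<Lambda> (\<lambda>\<tau>. f \<tau> + g \<tau>) = (\<lambda>\<sigma>. \<Lambda> f \<sigma> + \<Lambda> g \<sigma>)"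
    and scale: "\<And>r f. f \<in> AffT \<Longrightarrow> \<Lambda> (\<lambda>\<tau>. r * f \<tau>) = (\<lambda>\<sigma>. r * \<Lambda> f \<sigma>)"
    and hat: "\<And>a. a \<in> self_adjoint \<Longrightarrow> \<Lambda> (hat a) = hat (S_map \<theta> a)"
    using assms(6) by (auto simp: is_Lambda_def)
  obtain \<epsilon> :: real where \<epsilon>: "\<epsilon> = 1 \<or> \<epsilon> = -1" and S: "S_map \<theta> 1 = \<epsilon> *\<^sub>R 1"
    using S_map_one[OF assms(2-5)] .
  have hat_\<epsilon>: "hat (\<epsilon> *\<^sub>R (1 :: 'b)) = (\<lambda>\<sigma>. \<epsilon> * hat 1 \<sigma>)"
  proof
    fix \<sigma> :: "'b \<Rightarrow> complex"
    have "\<sigma> (complex_of_real \<epsilon> *\<^sub>C 1) = complex_of_real \<epsilon> * \<sigma> 1" if "\<sigma> \<in> tracial_states"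
      using that unfolding tracial_states_def by blast
    then show "hat (\<epsilon> *\<^sub>R 1) \<sigma> = \<epsilon> * hat 1 \<sigma>"
      by (simp add: hat_def scaleR_scaleC)
  qed
  have \<Lambda>1: "\<Lambda> (hat 1) = (\<lambda>\<sigma>. \<epsilon> * hat 1 \<sigma>)"
    using hat[of 1] S by (simp add: self_adjoint_def hat_\<epsilon>)
  \<comment> \<open>Multiplying by the sign once more makes the map preserve the order unit.\<close>
  define M where "M f \<sigma> = \<epsilon> * \<Lambda> f \<sigma>" for f \<sigma>
  have \<epsilon>2: "\<epsilon> * (\<epsilon> * r) = r" for r using \<epsilon> by auto
  have M_iff: "positive_map M \<longleftrightarrow> contractive_map M"
  proof (rule unital_positive_iff_contractive)
    fix f g :: "('a \<Rightarrow> complex) \<Rightarrow> real" and r :: real assume f: "f \<in> AffT"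
    show "M f \<in> AffT"
      using AffT_scale[OF maps[OF f], of \<epsilon>] by (simp add: M_def[abs_def])
    show "M (\<lambda>\<tau>. r * f \<tau>) = (\<lambda>\<sigma>. r * M f \<sigma>)"
      by (simp add: M_def[abs_def] scale[OF f] mult_ac)
    assume "g \<in> AffT"
    then show "M (\<lambda>\<tau>. f \<tau> + g \<tau>) = (\<lambda>\<sigma>. M f \<sigma> + M g \<sigma>)"
      by (simp add: M_def[abs_def] add[OF f] distrib_left)
  next
    show "M (hat 1) = hat 1" by (simp add: M_def[abs_def] \<Lambda>1 \<epsilon>2)
  qed
  \<comment> \<open>The opposite sign must also be handled: \<open>- M\<close> sends the order unit
    to -1, so it can be positive only if the target has no tracial states, and then positivity of
    \<open>M\<close> is vacuous.\<close>
  have M_pos: "positive_map M" if "positive_map (\<lambda>f \<sigma>. - M f \<sigma>)"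
  proof -
    have "(tracial_states :: ('b \<Rightarrow> complex) set) = {}"
    proof (rule ccontr)
      assume "(tracial_states :: ('b \<Rightarrow> complex) set) \<noteq> {}"
      then obtain \<sigma> :: "'b \<Rightarrow> complex" where \<sigma>: "\<sigma> \<in> tracial_states" by auto
      have "0 \<le> - M (hat 1) \<sigma>"
        using that hat_one_AffT \<sigma> by (auto simp: positive_map_def hat_one)
      then show False using \<sigma> \<epsilon> by (auto simp: M_def \<Lambda>1 hat_one)
    qed
    then show ?thesis by (simp add: positive_map_def)
  qed
  from \<epsilon> show ?thesis
  proof
    assume "\<epsilon> = 1"
    then have "M = \<Lambda>" by (simp add: M_def fun_eq_iff)
    then show ?thesis using M_iff M_pos by auto
  next
    assume "\<epsilon> = -1"
    then have "M = (\<lambda>f \<sigma>. - \<Lambda> f \<sigma>)" by (simp add: M_def fun_eq_iff)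
    then show ?thesis using M_iff M_pos contractive_map_uminus[of \<Lambda>] by auto
  qed
qed

end
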